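(* Let $\delta > 0$ and, for each $n \in \mathbb{N}$, let $X_n$ be a random variable taking values in $\{0,\ldots,n\}$ with standard deviation $\sigma_n$ and probability generating function $P_n$, where $\sigma_n \to \infty$ as $n \to \infty$. Let \[ S = \left\{ x + iy \in \mathbb{C} : x, y \in \mathbb{R},\ x \ge \frac{2x^2 + 2y^2}{1 + x^2 + y^2} \right\}, \] and let $N_n(\delta)$ be the number of zeros of $P_n$, counted with multiplicity, at distance at most $\delta$ from $S$. If every zero $\zeta$ of $P_n$ satisfies $|1-\zeta| > \delta$ for every $n$, and $N_n(\delta) = o(\sigma_n^3)$ as $n\to\infty$, then $\{X_n\}$ satisfies a central limit theorem.
   Context: The probability generating function of a random variable $X_n \in \{0,\ldots,n\}$ is the polynomial $P_n(z) = \sum_{k=0}^n \mathbb{P}(X_n = k) z^k$. A sequence $\{X_n\}$ with means $\mu_n$ and standard deviations $\sigma_n$ (positive for all large $n$) satisfies a central limit theorem if $X_n^* = (X_n - \mu_n)\sigma_n^{-1}$ converges in distribution to $Z \sim \mathcal{N}(0,1)$ as $n \to \infty$. *)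

theory Defs
  imports
    "HOL-Probability.Probability"
    "HOL-Library.Landau_Symbols"
    "HOL-Computational_Algebra.Polynomial"
begin

definition mean :: "'a measure \<Rightarrow> ('a \<Rightarrow> nat) \<Rightarrow> real" where
  "mean M X = prob_space.expectation M (\<lambda>\<omega>. real (X \<omega>))"

definition std_dev :: "'a measure \<Rightarrow> ('a \<Rightarrow> nat) \<Rightarrow> real" where
  "std_dev M X = sqrt (prob_space.variance M (\<lambda>\<omega>. real (X \<omega>)))"

text \<open>The coefficients are embedded into the complex numbers, since the complex zeros are of interest.\<close>

definition pgf :: "'a measure \<Rightarrow> ('a \<Rightarrow> nat) \<Rightarrow> nat \<Rightarrow> complex poly" where
  "pgf M X n = (\<Sum>k\<le>n. monom (complex_of_real \<P>(\<omega> in M. X \<omega> = k)) k)"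

definition region_S :: "complex set" where
  "region_S = {Complex x y | x y. x \<ge> (2 * x\<^sup>2 + 2 * y\<^sup>2) / (1 + x\<^sup>2 + y\<^sup>2)}"

text \<open>
  The multiset of zeros \<^const>\<open>proots\<close> carries multiplicities; it is empty for the zero polynomial,
  but \<^const>\<open>pgf\<close> is nonzero for a random variable with values in \<open>{0..n}\<close> (lemma \<open>pgf_nonzero\<close>).
  Likewise \<^const>\<open>infdist\<close> is the genuine distance, as \<^const>\<open>region_S\<close> is nonempty.
\<close>

definition zeros_near_S :: "real \<Rightarrow> complex poly \<Rightarrow> nat" where
  "zeros_near_S \<delta> p = size (filter_mset (\<lambda>\<zeta>. infdist \<zeta> region_S \<le> \<delta>) (proots p))"

text \<open>
  If the standard deviation of \<open>X n\<close> is 0, the standardized variable below is constantly 0. The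
  limit law is continuous, so this can happen for only finitely many \<open>n\<close> when the limit holds.
\<close>

definition satisfies_clt :: "(nat \<Rightarrow> 'a measure) \<Rightarrow> (nat \<Rightarrow> 'a \<Rightarrow> nat) \<Rightarrow> bool" where
  "satisfies_clt M X \<longleftrightarrow>
     weak_conv_m
       (\<lambda>n. distr (M n) borel (\<lambda>\<omega>. (real (X n \<omega>) - mean (M n) (X n)) / std_dev (M n) (X n)))
       std_normal_distribution"

lemma region_S_nonempty: "region_S \<noteq> {}"
proof -
  have "Complex 0 0 \<in> region_S"
    unfolding region_S_def by force
  then show ?thesis by blast
qed

lemma poly_pgf_1:
  assumes "prob_space M" and X: "X \<in> measurable M (count_space {0..n})"
  shows "poly (pgf M X n) 1 = 1"
proof -
  interpret prob_space M by fact
  have ev: "{\<omega> \<in> space M. X \<omega> = k} \<in> sets M" if "k \<le> n" for k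
  proof -
    have "X -` {k} \<inter> space M \<in> sets M"
      using that by (intro measurable_sets[OF X]) auto
    also have "X -` {k} \<inter> space M = {\<omega> \<in> space M. X \<omega> = k}" by auto
    finally show ?thesis .
  qed
  have "(\<Sum>k\<le>n. \<P>(\<omega> in M. X \<omega> = k)) = prob (\<Union>k\<le>n. {\<omega> \<in> space M. X \<omega> = k})"
    using ev by (intro finite_measure_finite_Union[symmetric]) (auto simp: disjoint_family_on_def)
  also have "(\<Union>k\<le>n. {\<omega> \<in> space M. X \<omega> = k}) = space M"
    using measurable_space[OF X] by auto
  finally have "(\<Sum>k\<le>n. \<P>(\<omega> in M. X \<omega> = k)) = 1" by (simp add: prob_space)
  then show ?thesis
    by (simp add: pgf_def poly_sum poly_monom flip: of_real_sum)
qed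

lemma pgf_nonzero:
  assumes "prob_space M" "X \<in> measurable M (count_space {0..n})"
  shows "pgf M X n \<noteq> 0"
  using poly_pgf_1[OF assms] by auto

end

theory Submission
  imports Defs "HOL-Computational_Algebra.Fundamental_Theorem_Algebra"
begin

text \<open>
  Let \<open>P\<close> be the generating function of a variable with mean \<open>\<mu>\<close> and standard deviation \<open>\<sigma>\<close>, and put
  \<open>u = 1 / (1 - \<zeta>)\<close> for each zero \<open>\<zeta>\<close>. Since \<open>P\<close> is \<open>1\<close> at \<open>1\<close>, it is the product of the factors
  \<open>1 + u * (z - 1)\<close>. Comparing derivatives at \<open>1\<close> gives \<open>\<mu> = \<Sum> u\<close> and \<open>\<sigma>\<^sup>2 = \<Sum> (u - u\<^sup>2)\<close>, and
  the logarithm of a factor at \<open>z = exp (\<i> * s)\<close> is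
  \<open>\<i> * s * u - s\<^sup>2 / 2 * (u - u\<^sup>2) + e * u + O((cmod u)\<^sup>2 * \<bar>s\<bar> ^ 3)\<close>, where \<open>e = O(\<bar>s\<bar> ^ 3)\<close> does not
  depend on the zero. Summed over all zeros, the first two terms become those of a normal
  characteristic function, and \<open>e * u\<close> becomes \<open>e * \<mu>\<close>. So the total error is at most
  a multiple of \<open>\<bar>s\<bar> ^ 3 * \<Sum> (\<bar>Re u\<bar> + (cmod u)\<^sup>2)\<close> (lemma \<open>prod_factors_expansion\<close>).

  The region \<open>S\<close> consists of \<open>1\<close> and of the points with \<open>Re (u - u\<^sup>2) \<le> 0\<close>, that is, of the zeros
  that do not increase the variance. Compactness, with a separate look at infinity, shows that a zero
  at distance more than \<open>\<delta>\<close> from \<open>S\<close> satisfies \<open>\<bar>Re u\<bar> + (cmod u)\<^sup>2 \<le> C * Re (u - u\<^sup>2)\<close>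
  (lemma \<open>variance_weight_dominates\<close>): its error is paid for by its contribution to the variance.
  The other \<open>N\<close> zeros have \<open>cmod u < 1 / \<delta>\<close>, hence bounded errors and bounded, possibly negative,
  contributions to the variance. Altogether the error is \<open>O((\<sigma>\<^sup>2 + N) * \<bar>s\<bar> ^ 3)\<close>
  (lemma \<open>poly_iexp_expansion\<close>).

  The standardized variable at \<open>t\<close> corresponds to \<open>s = t / \<sigma>\<close>, where the error is
  \<open>O(1 / \<sigma> + N / \<sigma> ^ 3)\<close> and tends to \<open>0\<close>. So the characteristic functions converge to
  \<open>exp (- t\<^sup>2 / 2)\<close>, and Levy's continuity theorem gives the limit law.
\<close>

section \<open>Expansion of a single factor\<close>

lemma Ln_approx_quadratic:
  assumes "cmod z \<le> 1/2"
  shows "cmod (Ln (1 + z) - z + z\<^sup>2 / 2) \<le> 8 * cmod z ^ 3"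
proof -
  define f :: "nat \<Rightarrow> complex \<Rightarrow> complex" where
    "f = (\<lambda>i. if i = 0 then (\<lambda>x. Ln (1 + x)) else if i = 1 then (\<lambda>x. inverse (1 + x))
      else if i = 2 then (\<lambda>x. - inverse ((1 + x)\<^sup>2)) else (\<lambda>x. 2 * inverse ((1 + x) ^ 3)))"
  let ?S = "cball (0 :: complex) (1/2)"
  have half: "cmod (1 + x) \<ge> 1/2" if "x \<in> ?S" for x
    using that norm_triangle_ineq2[of 1 "-x"] by simp
  have nz: "1 + x \<noteq> 0" if "x \<in> ?S" for x
    using half[OF that] by auto
  have cut: "1 + x \<notin> \<real>\<^sub>\<le>\<^sub>0" if "x \<in> ?S" for x
    using that abs_Re_le_cmod[of x] by (auto simp: complex_nonpos_Reals_iff)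
  have "cmod (f 0 z - (\<Sum>i\<le>2. f i 0 * (z - 0) ^ i / fact i)) \<le> 16 * cmod (z - 0) ^ Suc 2 / fact 2"
  proof (rule complex_Taylor)
    fix i :: nat and x :: complex
    assume x: "x \<in> ?S" and i: "i \<le> 2"
    then consider "i = 0" | "i = 1" | "i = 2" by linarith
    then show "(f i has_field_derivative f (Suc i) x) (at x within ?S)"
    proof cases
      case 1
      then show ?thesis
        unfolding f_def using cut[OF x] by (auto intro!: derivative_eq_intros simp: inverse_eq_divide)
    next
      case 2
      then show ?thesis
        unfolding f_def using nz[OF x]
        by (auto intro!: derivative_eq_intros simp: power2_eq_square)
    next
      case 3
      then show ?thesis
        unfolding f_def using nz[OF x]
        by (auto intro!: derivative_eq_intros simp: divide_simps, simp add: algebra_simps eval_nat_numeral)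
    qed
  next
    fix x :: complex assume x: "x \<in> ?S"
    have "cmod (1 + x) ^ 3 \<ge> (1/2) ^ 3"
      using half[OF x] by (intro power_mono) auto
    then have "inverse (cmod (1 + x) ^ 3) \<le> inverse ((1/2) ^ 3)"
      by (intro le_imp_inverse_le) auto
    then show "cmod (f (Suc 2) x) \<le> 16"
      by (simp add: f_def norm_mult norm_inverse norm_power power_divide)
  qed (use assms in auto)
  moreover have "(\<Sum>i\<le>2. f i 0 * (z - 0) ^ i / fact i) = z - z\<^sup>2 / 2"
  proof -
    have "{..2 :: nat} = {0, 1, 2}" by auto
    then show ?thesis by (simp add: f_def)
  qed
  moreover have "f 0 z = Ln (1 + z)" by (simp add: f_def)
  ultimately have "cmod (Ln (1 + z) - (z - z\<^sup>2 / 2)) \<le> 8 * cmod z ^ 3" by simp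
  then show ?thesis by (simp add: algebra_simps)
qed

text \<open>
  The part of the error of a factor that is linear in \<open>u = 1 / (1 - \<zeta>)\<close> is \<open>iexp_remainder s * u\<close>. It is
  kept exact instead of being bounded, since summed over all zeros it is a multiple of the mean, a real
  number, and so only the real parts of the \<open>u\<close> enter.
\<close>

definition iexp_remainder :: "real \<Rightarrow> complex" where
  "iexp_remainder s = iexp s - 1 - \<i> * s + s\<^sup>2 / 2"

lemma norm_iexp_remainder_le: "cmod (iexp_remainder s) \<le> \<bar>s\<bar> ^ 3"
proof -
  have "cmod (iexp s - (\<Sum>k\<le>2. (\<i> * s) ^ k / fact k)) \<le> \<bar>s\<bar> ^ Suc 2 / fact (Suc 2)"
    by (rule iexp_approx1)
  also have "\<dots> = \<bar>s\<bar> ^ 3 / 6" by (simp add: fact_numeral)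
  also have "\<dots> \<le> \<bar>s\<bar> ^ 3" using zero_le_power[of "\<bar>s\<bar>" 3] by linarith
  also have "iexp s - (\<Sum>k\<le>2. (\<i> * s) ^ k / fact k) = iexp_remainder s"
    by (simp add: iexp_remainder_def numeral_2_eq_2 algebra_simps)
  finally show ?thesis .
qed

text \<open>
  The error is quadratic in \<open>u\<close>, not linear, which is what makes zeros of large modulus harmless:
  their contribution to the variance can be as small as a multiple of \<open>(cmod u)\<^sup>2\<close>. A bound linear in
  \<open>cmod u\<close> would be too weak.
\<close>

lemma Ln_factor_expansion:
  fixes u :: complex and s K :: real
  assumes u: "cmod u \<le> K" and K: "K \<ge> 1" and s: "K * \<bar>s\<bar> \<le> 1/2"
  shows "cmod (Ln (1 + u * (iexp s - 1)) - (\<i> * s * u - s\<^sup>2 / 2 * (u - u\<^sup>2) + iexp_remainder s * u))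
           \<le> 9 * K * (cmod u)\<^sup>2 * \<bar>s\<bar> ^ 3"
proof -
  define w where "w = iexp s - 1"
  have rem: "iexp_remainder s = w - \<i> * s + s\<^sup>2 / 2"
    by (simp add: iexp_remainder_def w_def)
  have w1: "cmod w \<le> \<bar>s\<bar>"
    using iexp_approx1[of s 0] by (simp add: w_def)
  have w2: "cmod (w - \<i> * s) \<le> s\<^sup>2 / 2"
    using iexp_approx1[of s 1] by (simp add: w_def numeral_2_eq_2 algebra_simps)
  have "cmod (w\<^sup>2 + s\<^sup>2) = cmod (w - \<i> * s) * cmod (w + \<i> * s)"
    by (simp flip: norm_mult add: algebra_simps power2_eq_square)
  also have "\<dots> \<le> s\<^sup>2 / 2 * (2 * \<bar>s\<bar>)"
    using norm_triangle_ineq[of w "\<i> * s"] w1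
    by (intro mult_mono w2) (auto simp: norm_mult)
  finally have sq: "cmod (w\<^sup>2 + s\<^sup>2) \<le> \<bar>s\<bar> ^ 3"
    by (simp add: power3_eq_cube power2_eq_square)
  have uw: "cmod (u * w) \<le> K * \<bar>s\<bar>"
    unfolding norm_mult using u w1 K by (intro mult_mono) auto
  have "cmod (u * w) ^ 3 = (cmod u)\<^sup>2 * cmod u * cmod w ^ 3"
    by (simp add: norm_mult power_mult_distrib power2_eq_square power3_eq_cube)
  also have "\<dots> \<le> (cmod u)\<^sup>2 * K * \<bar>s\<bar> ^ 3"
    using u w1 K by (intro mult_mono power_mono) auto
  finally have cube: "cmod (u * w) ^ 3 \<le> (cmod u)\<^sup>2 * K * \<bar>s\<bar> ^ 3" .
  \<comment> \<open>Writing \<open>w = \<i> * s - s\<^sup>2 / 2 + iexp_remainder s\<close> in the linear term and \<open>w\<^sup>2 = - s\<^sup>2 + (w\<^sup>2 + s\<^sup>2)\<close> in the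
    quadratic one leaves two errors, of orders three and two in \<open>u\<close>.\<close>
  have "Ln (1 + u * w) - (\<i> * s * u - s\<^sup>2 / 2 * (u - u\<^sup>2) + iexp_remainder s * u)
      = (Ln (1 + u * w) - u * w + (u * w)\<^sup>2 / 2) - u\<^sup>2 / 2 * (w\<^sup>2 + s\<^sup>2)"
    unfolding rem by (simp add: field_simps power_mult_distrib)
  also have "cmod \<dots> \<le> 8 * cmod (u * w) ^ 3 + (cmod u)\<^sup>2 / 2 * cmod (w\<^sup>2 + s\<^sup>2)"
    using Ln_approx_quadratic[of "u * w"] uw s
    by (intro order_trans[OF norm_triangle_ineq4] add_mono)
       (auto simp: norm_mult norm_divide norm_power)
  also have "\<dots> \<le> 8 * ((cmod u)\<^sup>2 * K * \<bar>s\<bar> ^ 3) + (cmod u)\<^sup>2 / 2 * \<bar>s\<bar> ^ 3"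
    using cube sq by (intro add_mono mult_left_mono) auto
  also have "\<dots> \<le> 8 * ((cmod u)\<^sup>2 * K * \<bar>s\<bar> ^ 3) + (cmod u)\<^sup>2 * K * \<bar>s\<bar> ^ 3"
  proof -
    have "(cmod u)\<^sup>2 / 2 \<le> (cmod u)\<^sup>2 * K"
      using mult_left_mono[OF K, of "(cmod u)\<^sup>2"] zero_le_power2[of "cmod u"] by linarith
    then show ?thesis using K by (intro add_mono mult_right_mono) auto
  qed
  also have "\<dots> = 9 * K * (cmod u)\<^sup>2 * \<bar>s\<bar> ^ 3"
    by simp
  finally show ?thesis
    unfolding w_def .
qed

section \<open>Zeros away from the region\<close>

text \<open>
  The amount by which the inequality defining \<^const>\<open>region_S\<close> fails. Up to a positive factor it is
  the real part of the contribution of the zero to the variance (lemma \<open>Re_variance_weight\<close>).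
\<close>

definition gap :: "complex \<Rightarrow> real" where
  "gap \<zeta> = 2 * (cmod \<zeta>)\<^sup>2 / (1 + (cmod \<zeta>)\<^sup>2) - Re \<zeta>"

lemma mem_region_S_iff: "\<zeta> \<in> region_S \<longleftrightarrow> gap \<zeta> \<le> 0"
proof -
  have "\<zeta> \<in> region_S \<longleftrightarrow>
      Re \<zeta> \<ge> (2 * (Re \<zeta>)\<^sup>2 + 2 * (Im \<zeta>)\<^sup>2) / (1 + (Re \<zeta>)\<^sup>2 + (Im \<zeta>)\<^sup>2)"
    by (cases \<zeta>) (simp add: region_S_def)
  then show ?thesis
    by (simp add: gap_def cmod_power2 algebra_simps)
qed

text \<open>
  On bounded sets this is compactness. Near infinity \<open>gap \<zeta>\<close> is close to \<open>2 - Re \<zeta>\<close>, and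
  \<open>Re \<zeta> < 2 - \<delta>\<close> because the translate \<open>\<zeta> + \<delta>\<close> is still outside the region.
\<close>

lemma gap_bounded_below_away_from_S:
  assumes "\<delta> > 0"
  shows "\<exists>c>0. \<forall>\<zeta>. infdist \<zeta> region_S > \<delta> \<longrightarrow> gap \<zeta> \<ge> c"
proof -
  have pos: "gap \<zeta> > 0" if "infdist \<zeta> region_S > 0" for \<zeta>
    using that mem_region_S_iff[of \<zeta>] by (cases "gap \<zeta> \<le> 0") auto
  define R where "R = 1 + 4 / \<delta>"
  have R: "R \<ge> 1" "4 / \<delta> \<le> R\<^sup>2"
    using assms by (auto simp: R_def power2_eq_square field_simps)
  have far: "gap \<zeta> \<ge> \<delta> / 2" if dist: "infdist \<zeta> region_S > \<delta>" and large: "cmod \<zeta> \<ge> R" for \<zeta>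
  proof -
    have less2: "2 * (cmod z)\<^sup>2 / (1 + (cmod z)\<^sup>2) < 2" for z :: complex
      by (auto simp: divide_simps add_pos_nonneg)
    have "\<zeta> + of_real \<delta> \<notin> region_S"
      using infdist_le[of "\<zeta> + of_real \<delta>" region_S \<zeta>] dist assms by (auto simp: dist_norm)
    then have "Re \<zeta> < 2 - \<delta>"
      using less2[of "\<zeta> + of_real \<delta>"] by (simp add: mem_region_S_iff gap_def)
    moreover have "2 * (cmod \<zeta>)\<^sup>2 / (1 + (cmod \<zeta>)\<^sup>2) \<ge> 2 - \<delta> / 2"
    proof -
      have "4 / \<delta> \<le> (cmod \<zeta>)\<^sup>2"
        using R large power_mono[of R "cmod \<zeta>" 2] by linarith
      then have "4 \<le> \<delta> * (1 + (cmod \<zeta>)\<^sup>2)"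
        using assms by (simp add: field_simps) 
      moreover have "1 + (cmod \<zeta>)\<^sup>2 > 0"
        by (simp add: add_pos_nonneg)
      ultimately show ?thesis
        by (simp add: field_simps)
    qed
    ultimately show ?thesis
      by (simp add: gap_def)
  qed
  define A where "A = cball 0 R \<inter> {\<zeta>. infdist \<zeta> region_S \<ge> \<delta>}"
  have "compact A"
    unfolding A_def by (intro compact_Int_closed closed_Collect_le continuous_intros) auto
  have "\<exists>c>0. \<forall>\<zeta>\<in>A. gap \<zeta> \<ge> c"
  proof (cases "A = {}")
    case False
    have "1 + (cmod \<zeta>)\<^sup>2 \<noteq> 0" for \<zeta>
      by (smt (verit) zero_le_power2)
    then have "continuous_on A gap"
      unfolding gap_def by (intro continuous_intros) auto
    with \<open>compact A\<close> False obtain \<zeta>\<^sub>0 where \<zeta>\<^sub>0: "\<zeta>\<^sub>0 \<in> A" "\<And>\<zeta>. \<zeta> \<in> A \<Longrightarrow> gap \<zeta>\<^sub>0 \<le> gap \<zeta>"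
      using continuous_attains_inf[of A gap] by blast
    then show ?thesis
      using pos[of \<zeta>\<^sub>0] assms by (intro exI[of _ "gap \<zeta>\<^sub>0"]) (auto simp: A_def)
  qed (auto intro: exI[of _ 1])
  then obtain c where c: "c > 0" "\<And>\<zeta>. \<zeta> \<in> A \<Longrightarrow> gap \<zeta> \<ge> c" by blast
  have "gap \<zeta> \<ge> min c (\<delta> / 2)" if "infdist \<zeta> region_S > \<delta>" for \<zeta>
    using far[of \<zeta>] c(2)[of \<zeta>] that by (cases "cmod \<zeta> \<le> R") (auto simp: A_def)
  then show ?thesis
    using c(1) assms by (intro exI[of _ "min c (\<delta> / 2)"]) auto
qed

text \<open>
  A zero at \<open>\<zeta>\<close> contributes \<open>u - u\<^sup>2 = - \<zeta> / (1 - \<zeta>)\<^sup>2\<close> to the variance, so the zeros in \<^const>\<open>region_S\<close>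
  are those whose contribution has nonpositive real part.
\<close>

lemma Re_variance_weight:
  assumes "\<zeta> \<noteq> 1"
  defines "u \<equiv> inverse (1 - \<zeta>)"
  shows "Re (u - u\<^sup>2) = gap \<zeta> * (1 + (cmod \<zeta>)\<^sup>2) * cmod u ^ 4"
proof -
  define D where "D = (cmod (1 - \<zeta>))\<^sup>2"
  have D: "D > 0" "D = (1 - Re \<zeta>)\<^sup>2 + (Im \<zeta>)\<^sup>2"
    using assms by (simp add: D_def, simp add: D_def cmod_power2)
  have "Re (u - u\<^sup>2) = Re u - ((Re u)\<^sup>2 - (Im u)\<^sup>2)"
    by (simp add: power2_eq_square)
  also have "Re u = (1 - Re \<zeta>) / D"
    by (simp add: u_def D(2))
  also have "Im u = Im \<zeta> / D"
    by (simp add: u_def D(2))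
  also have "(1 - Re \<zeta>) / D - (((1 - Re \<zeta>) / D)\<^sup>2 - (Im \<zeta> / D)\<^sup>2)
      = (1 - Re \<zeta>) / D - ((1 - Re \<zeta>)\<^sup>2 - (Im \<zeta>)\<^sup>2) / D\<^sup>2"
    by (simp only: power_divide diff_divide_distrib[of "(1 - Re \<zeta>)\<^sup>2"])
  also have "\<dots> = ((1 - Re \<zeta>) * D - ((1 - Re \<zeta>)\<^sup>2 - (Im \<zeta>)\<^sup>2)) / D\<^sup>2"
    using D(1) by (simp add: field_simps power2_eq_square)
  also have "(1 - Re \<zeta>) * D - ((1 - Re \<zeta>)\<^sup>2 - (Im \<zeta>)\<^sup>2)
      = 2 * (cmod \<zeta>)\<^sup>2 - Re \<zeta> * (1 + (cmod \<zeta>)\<^sup>2)"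
    unfolding D(2) cmod_power2 by algebra
  also have "\<dots> = gap \<zeta> * (1 + (cmod \<zeta>)\<^sup>2)"
  proof -
    have "1 + (cmod \<zeta>)\<^sup>2 > 0" by (simp add: add_pos_nonneg)
    then show ?thesis by (simp add: gap_def field_simps)
  qed
  finally have "Re (u - u\<^sup>2) = gap \<zeta> * (1 + (cmod \<zeta>)\<^sup>2) * (1 / D\<^sup>2)" by simp
  moreover have "1 / D\<^sup>2 = cmod u ^ 4"
    by (simp add: D_def u_def norm_divide power_divide inverse_eq_divide flip: power_mult)
  ultimately show ?thesis by simp
qed

text \<open>
  The left-hand side measures the cubic error caused by the zero, so zeros away from the region pay for
  their error with their own share of the variance. In \<open>Re_variance_weight\<close>, \<open>gap \<zeta>\<close> is at least a
  constant and \<open>(1 + (cmod \<zeta>)\<^sup>2) * (cmod u)\<^sup>2\<close> is at least \<open>1 / 2\<close>.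
\<close>

lemma variance_weight_dominates:
  assumes "\<delta> > 0"
  obtains C :: real where "C > 0"
    "\<And>\<zeta> u. \<zeta> \<noteq> 1 \<Longrightarrow> infdist \<zeta> region_S > \<delta> \<Longrightarrow> u = inverse (1 - \<zeta>) \<Longrightarrow>
      \<bar>Re u\<bar> + (cmod u)\<^sup>2 \<le> C * Re (u - u\<^sup>2)"
proof -
  obtain c where c: "c > 0" "\<And>\<zeta>. infdist \<zeta> region_S > \<delta> \<Longrightarrow> gap \<zeta> \<ge> c"
    using gap_bounded_below_away_from_S[OF assms] by blast
  have "\<bar>Re u\<bar> + (cmod u)\<^sup>2 \<le> (1 + 8 / c) * Re (u - u\<^sup>2)"
    if "\<zeta> \<noteq> 1" "infdist \<zeta> region_S > \<delta>" and u: "u = inverse (1 - \<zeta>)" for \<zeta> u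
  proof -
    let ?v = "Re (u - u\<^sup>2)"
    have "(cmod (1 - \<zeta>))\<^sup>2 \<le> (1 + cmod \<zeta>)\<^sup>2"
      using norm_triangle_ineq4[of 1 \<zeta>] by (intro power_mono) auto
    also have "\<dots> \<le> 2 * (1 + (cmod \<zeta>)\<^sup>2)"
      using zero_le_power2[of "1 - cmod \<zeta>"] by (simp add: power2_eq_square algebra_simps)
    finally have "1 \<le> 2 * (1 + (cmod \<zeta>)\<^sup>2) * (cmod u)\<^sup>2"
      using that(1)
      by (simp add: u norm_inverse power_inverse pos_le_divide_eq flip: divide_inverse)
    then have "c * (cmod u)\<^sup>2 * 1 \<le> c * (cmod u)\<^sup>2 * (2 * (1 + (cmod \<zeta>)\<^sup>2) * (cmod u)\<^sup>2)"
      using c(1) by (intro mult_left_mono) auto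
    also have "\<dots> = 2 * (c * ((1 + (cmod \<zeta>)\<^sup>2) * cmod u ^ 4))"
      by (simp add: power2_eq_square power4_eq_xxxx mult_ac)
    also have "\<dots> \<le> 2 * (gap \<zeta> * ((1 + (cmod \<zeta>)\<^sup>2) * cmod u ^ 4))"
      using c(2)[OF that(2)] by (intro mult_left_mono mult_right_mono) auto
    also have "\<dots> = 2 * ?v"
      using Re_variance_weight[OF that(1)] by (simp add: u mult_ac)
    finally have sq: "(cmod u)\<^sup>2 \<le> 2 / c * ?v"
      using c(1) by (simp add: field_simps)
    then have "?v \<ge> 0"
      using c(1) by (smt (verit) divide_pos_pos mult_pos_neg zero_le_power2)
    \<comment> \<open>No sign of the real part is known; the bound comes from \<open>Re u = ?v + Re (u\<^sup>2)\<close>.\<close>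
    have "\<bar>Re u\<bar> \<le> ?v + (cmod u)\<^sup>2"
      using abs_Re_le_cmod[of "u\<^sup>2"] \<open>?v \<ge> 0\<close> by (auto simp: norm_power)
    with sq have "\<bar>Re u\<bar> + (cmod u)\<^sup>2 \<le> ?v + 2 * (2 / c * ?v)" by linarith
    also have "\<dots> \<le> (1 + 8 / c) * ?v"
      using \<open>?v \<ge> 0\<close> c(1) by (simp add: field_simps)
    finally show ?thesis .
  qed
  moreover have "1 + 8 / c > 0"
    using c(1) by (simp add: add_pos_pos)
  ultimately show thesis
    by (intro that[of "1 + 8 / c"])
qed

section \<open>Moments from the generating function\<close>

lemma integral_comp_finite_range:
  fixes g :: "nat \<Rightarrow> 'b :: {banach, second_countable_topology}"
  assumes "prob_space M" and X: "X \<in> measurable M (count_space {0..n})"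
  shows "(\<integral>\<omega>. g (X \<omega>) \<partial>M) = (\<Sum>k\<le>n. \<P>(\<omega> in M. X \<omega> = k) *\<^sub>R g k)"
proof -
  interpret prob_space M by fact
  let ?E = "\<lambda>k. {\<omega> \<in> space M. X \<omega> = k}"
  have ev: "?E k \<in> sets M" if "k \<le> n" for k
  proof -
    have "X -` {k} \<inter> space M \<in> sets M"
      using that by (intro measurable_sets[OF X]) auto
    also have "X -` {k} \<inter> space M = ?E k" by auto
    finally show ?thesis .
  qed
  have int: "integrable M (indicator (?E k) :: _ \<Rightarrow> real)" if "k \<le> n" for k
    using ev[OF that] by (simp add: emeasure_eq_measure)
  have "(\<integral>\<omega>. g (X \<omega>) \<partial>M) = (\<integral>\<omega>. (\<Sum>k\<le>n. indicator (?E k) \<omega> *\<^sub>R g k) \<partial>M)"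
  proof (rule Bochner_Integration.integral_cong)
    fix \<omega> assume \<omega>: "\<omega> \<in> space M"
    then have "X \<omega> \<le> n" using measurable_space[OF X] by auto
    moreover have "(\<Sum>k\<le>n. indicator (?E k) \<omega> *\<^sub>R g k) = (\<Sum>k\<le>n. if X \<omega> = k then g k else 0)"
      using \<omega> by (intro sum.cong) (auto simp: indicator_def)
    ultimately show "g (X \<omega>) = (\<Sum>k\<le>n. indicator (?E k) \<omega> *\<^sub>R g k)" by simp
  qed simp
  also have "\<dots> = (\<Sum>k\<le>n. \<integral>\<omega>. indicator (?E k) \<omega> *\<^sub>R g k \<partial>M)"
    using int by (intro Bochner_Integration.integral_sum integrable_scaleR_left) auto
  also have "\<dots> = (\<Sum>k\<le>n. prob (?E k) *\<^sub>R g k)"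
    using int ev by (intro sum.cong) (auto simp: Int_absorb1 sets.sets_into_space)
  finally show ?thesis .
qed

lemma poly_pgf_eq_integral:
  assumes "prob_space M" "X \<in> measurable M (count_space {0..n})"
  shows "poly (pgf M X n) z = (\<integral>\<omega>. z ^ X \<omega> \<partial>M)"
  using integral_comp_finite_range[OF assms, of "\<lambda>k. z ^ k"]
  by (simp add: pgf_def poly_sum poly_monom scaleR_conv_of_real)

lemma pderiv_sum: "pderiv (sum f A) = (\<Sum>x\<in>A. pderiv (f x))"
  using higher_pderiv_sum[of 1 f A] by simp

lemma pderiv_pgf_at_1:
  assumes "prob_space M" "X \<in> measurable M (count_space {0..n})"
  shows "poly (pderiv (pgf M X n)) 1 = of_real (mean M X)"
  using integral_comp_finite_range[OF assms, of real]
  by (simp add: pgf_def mean_def pderiv_sum pderiv_monom poly_sum poly_monom mult.commute)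

lemma pderiv2_pgf_at_1:
  assumes "prob_space M" "X \<in> measurable M (count_space {0..n})"
  shows "poly (pderiv (pderiv (pgf M X n))) 1
    = of_real ((std_dev M X)\<^sup>2 + (mean M X)\<^sup>2 - mean M X)"
proof -
  interpret prob_space M by fact
  define q where "q k = \<P>(\<omega> in M. X \<omega> = k)" for k
  define \<mu> where "\<mu> = mean M X"
  have E: "expectation (\<lambda>\<omega>. g (X \<omega>)) = (\<Sum>k\<le>n. q k * g k)" for g :: "nat \<Rightarrow> real"
    using integral_comp_finite_range[OF assms, of g] by (simp add: q_def)
  have total: "(\<Sum>k\<le>n. q k) = 1"
    using E[of "\<lambda>_. 1"] by (simp add: prob_space)
  have mean: "(\<Sum>k\<le>n. q k * real k) = \<mu>"
    using E[of real] by (simp add: \<mu>_def mean_def)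
  have "(std_dev M X)\<^sup>2 = expectation (\<lambda>\<omega>. (real (X \<omega>) - \<mu>)\<^sup>2)"
    by (simp add: std_dev_def \<mu>_def mean_def)
  also have "\<dots> = (\<Sum>k\<le>n. q k * (real k - \<mu>)\<^sup>2)"
    by (rule E)
  also have "\<dots> = (\<Sum>k\<le>n. q k * (real k * (real k - 1)) + (1 - 2 * \<mu>) * (q k * real k) + \<mu>\<^sup>2 * q k)"
    by (intro sum.cong) (auto simp: power2_eq_square algebra_simps)
  also have "\<dots> = (\<Sum>k\<le>n. q k * (real k * (real k - 1))) + (1 - 2 * \<mu>) * \<mu> + \<mu>\<^sup>2"
    by (simp add: sum.distrib total mean flip: sum_distrib_left)
  finally have "(\<Sum>k\<le>n. q k * (real k * (real k - 1))) = (std_dev M X)\<^sup>2 + \<mu>\<^sup>2 - \<mu>"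
    by (simp add: power2_eq_square algebra_simps)
  moreover have "poly (pderiv (pderiv (pgf M X n))) 1
      = (\<Sum>k\<le>n. of_real (q k * (real k * (real k - 1))))"
    unfolding pgf_def pderiv_sum pderiv_monom poly_sum poly_monom
    by (intro sum.cong) (auto simp: q_def of_nat_diff Suc_le_eq split: nat_diff_split)
  ultimately show ?thesis
    unfolding \<mu>_def of_real_sum[symmetric] by simp
qed

section \<open>Expansion over all zeros\<close>

lemma derivs_prod_factors_at_1:
  fixes u :: "'i \<Rightarrow> complex"
  assumes "finite I"
  defines "p \<equiv> (\<Prod>i\<in>I. [:1 - u i, u i:])"
  shows "poly p 1 = 1"
    and "poly (pderiv p) 1 = (\<Sum>i\<in>I. u i)"
    and "poly (pderiv (pderiv p)) 1 = (\<Sum>i\<in>I. u i)\<^sup>2 - (\<Sum>i\<in>I. (u i)\<^sup>2)"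
proof -
  have "poly p 1 = 1 \<and> poly (pderiv p) 1 = (\<Sum>i\<in>I. u i) \<and>
    poly (pderiv (pderiv p)) 1 = (\<Sum>i\<in>I. u i)\<^sup>2 - (\<Sum>i\<in>I. (u i)\<^sup>2)"
    unfolding p_def using assms(1)
    by (induction rule: finite_induct)
       (auto simp: pderiv_mult pderiv_add pderiv_smult pderiv_pCons pderiv_1 poly_prod power2_eq_square algebra_simps)
  then show "poly p 1 = 1" and "poly (pderiv p) 1 = (\<Sum>i\<in>I. u i)"
    and "poly (pderiv (pderiv p)) 1 = (\<Sum>i\<in>I. u i)\<^sup>2 - (\<Sum>i\<in>I. (u i)\<^sup>2)"
    by blast+
qed

text \<open>
  Each factor \<open>z - \<zeta>\<close> is rescaled to be \<open>1\<close> at \<open>1\<close>; it becomes \<open>1 + u * (z - 1)\<close>, so the polynomial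
  looks like the generating function of a sum of independent Bernoulli variables with complex
  success parameters \<open>u = 1 / (1 - \<zeta>)\<close>.
\<close>

lemma factorization_normalized_at_1:
  fixes p :: "complex poly"
  assumes p1: "poly p 1 = 1" and xs: "mset xs = proots p"
  shows "p = (\<Prod>i<length xs. [:1 - inverse (1 - xs ! i), inverse (1 - xs ! i):])"
proof -
  have "(\<Prod>x\<in>#proots p. [:-x, 1:]) = (\<Prod>x\<leftarrow>xs. [:-x, 1:])"
    by (subst prod_mset_prod_list [symmetric]) (simp add: xs)
  also have "\<dots> = (\<Prod>i<length xs. [:- xs ! i, 1:])"
    by (subst prod.list_conv_set_nth) (auto simp: atLeast0LessThan)
  finally have p: "p = smult (lead_coeff p) (\<Prod>i<length xs. [:- xs ! i, 1:])"
    using complex_poly_decompose_multiset[of p] by simp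
  have "lead_coeff p * (\<Prod>i<length xs. 1 - xs ! i) = poly (smult (lead_coeff p) (\<Prod>i<length xs. [:- xs ! i, 1:])) 1"
    by (simp add: poly_prod)
  also have "\<dots> = 1"
    using p p1 by simp
  finally have lead: "lead_coeff p * (\<Prod>i<length xs. 1 - xs ! i) = 1" .
  then have "(\<Prod>i<length xs. 1 - xs ! i) \<noteq> 0"
    by (metis mult_zero_right zero_neq_one)
  then have nz: "1 - xs ! i \<noteq> 0" if "i < length xs" for i
    using that by (subst (asm) prod_zero_iff) auto
  have lc: "lead_coeff p = (\<Prod>i<length xs. inverse (1 - xs ! i))"
    using inverse_unique[of "\<Prod>i<length xs. 1 - xs ! i" "lead_coeff p"] lead
      prod_inversef[of "\<lambda>i. 1 - xs ! i" "{..<length xs}"]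
    by (simp add: o_def mult.commute)
  have "p = smult (\<Prod>i<length xs. inverse (1 - xs ! i)) (\<Prod>i<length xs. [:- xs ! i, 1:])"
    using p unfolding lc .
  also have "\<dots> = (\<Prod>i<length xs. smult (inverse (1 - xs ! i)) [:- xs ! i, 1:])"
    by (rule prod_smult[symmetric])
  also have "\<dots> = (\<Prod>i<length xs. [:1 - inverse (1 - xs ! i), inverse (1 - xs ! i):])"
    using nz by (intro prod.cong) (auto simp: field_simps)
  finally show ?thesis .
qed

text \<open>
  Although the weights are complex, their sum is the real mean. This replaces the linear part of the
  error by the sum of the real parts, which \<open>variance_weight_dominates\<close> controls; the imaginary parts
  are only controlled to second order.
\<close>

lemma prod_factors_expansion:
  fixes u :: "'i \<Rightarrow> complex" and \<mu> v s K :: real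
  assumes fin: "finite I" and u: "\<And>i. i \<in> I \<Longrightarrow> cmod (u i) \<le> K"
    and K: "K \<ge> 1" and s: "K * \<bar>s\<bar> \<le> 1/2"
    and mean: "(\<Sum>i\<in>I. u i) = of_real \<mu>" and var: "(\<Sum>i\<in>I. u i - (u i)\<^sup>2) = of_real v"
  shows "\<exists>R. cmod R \<le> 9 * K * (\<Sum>i\<in>I. \<bar>Re (u i)\<bar> + (cmod (u i))\<^sup>2) * \<bar>s\<bar> ^ 3 \<and>
    (\<Prod>i\<in>I. 1 + u i * (iexp s - 1)) = exp (\<i> * s * \<mu> - s\<^sup>2 / 2 * v + R)"
proof -
  define L where "L i = Ln (1 + u i * (iexp s - 1))" for i
  define r where "r i = L i - (\<i> * s * u i - s\<^sup>2 / 2 * (u i - (u i)\<^sup>2) + iexp_remainder s * u i)" for i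
  define R where "R = (\<Sum>i\<in>I. r i) + iexp_remainder s * \<mu>"
  have exp_L: "exp (L i) = 1 + u i * (iexp s - 1)" if "i \<in> I" for i
  proof -
    have "cmod (u i * (iexp s - 1)) \<le> K * \<bar>s\<bar>"
      unfolding norm_mult using u[OF that] K iexp_approx1[of s 0] by (intro mult_mono) auto
    with s have "cmod (u i * (iexp s - 1)) < 1" by linarith
    then have "u i * (iexp s - 1) \<noteq> - 1" by auto
    then have "1 + u i * (iexp s - 1) \<noteq> 0"
      by (metis add.commute eq_neg_iff_add_eq_0)
    then show ?thesis by (simp add: L_def)
  qed
  have "(\<Sum>i\<in>I. L i) = (\<Sum>i\<in>I. r i + (\<i> * s * u i - s\<^sup>2 / 2 * (u i - (u i)\<^sup>2) + iexp_remainder s * u i))"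
    by (simp add: r_def)
  also have "\<dots> = (\<Sum>i\<in>I. r i) + (\<i> * s * (\<Sum>i\<in>I. u i) - s\<^sup>2 / 2 * (\<Sum>i\<in>I. u i - (u i)\<^sup>2)
      + iexp_remainder s * (\<Sum>i\<in>I. u i))"
    by (simp only: sum.distrib sum_distrib_left sum_subtractf[where f = "\<lambda>i. \<i> * s * u i"])
  also have "\<dots> = \<i> * s * \<mu> - s\<^sup>2 / 2 * v + R"
    unfolding mean var R_def by simp
  finally have "(\<Prod>i\<in>I. 1 + u i * (iexp s - 1)) = exp (\<i> * s * \<mu> - s\<^sup>2 / 2 * v + R)"
    using exp_sum[OF fin, of L] exp_L by (simp cong: prod.cong)
  moreover have "cmod R \<le> 9 * K * (\<Sum>i\<in>I. \<bar>Re (u i)\<bar> + (cmod (u i))\<^sup>2) * \<bar>s\<bar> ^ 3"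
  proof -
    have "cmod (\<Sum>i\<in>I. r i) \<le> (\<Sum>i\<in>I. 9 * K * (cmod (u i))\<^sup>2 * \<bar>s\<bar> ^ 3)"
      using Ln_factor_expansion[OF u K s] by (intro sum_norm_le) (simp add: r_def L_def)
    moreover have "cmod (iexp_remainder s * \<mu>) \<le> (\<Sum>i\<in>I. 9 * K * \<bar>Re (u i)\<bar> * \<bar>s\<bar> ^ 3)"
    proof -
      have "\<mu> = (\<Sum>i\<in>I. Re (u i))"
        using mean by (metis Re_complex_of_real Re_sum)
      then have "\<bar>\<mu>\<bar> \<le> (\<Sum>i\<in>I. \<bar>Re (u i)\<bar>)" by simp
      then have "cmod (iexp_remainder s * \<mu>) \<le> \<bar>s\<bar> ^ 3 * (\<Sum>i\<in>I. \<bar>Re (u i)\<bar>)"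
        unfolding norm_mult by (intro mult_mono norm_iexp_remainder_le) (auto intro: sum_nonneg)
      also have "\<dots> = (\<Sum>i\<in>I. 1 * \<bar>Re (u i)\<bar> * \<bar>s\<bar> ^ 3)"
        by (simp add: sum_distrib_left mult.commute)
      also have "\<dots> \<le> (\<Sum>i\<in>I. 9 * K * \<bar>Re (u i)\<bar> * \<bar>s\<bar> ^ 3)"
        using K by (intro sum_mono mult_right_mono) auto
      finally show ?thesis .
    qed
    ultimately have "cmod R \<le> (\<Sum>i\<in>I. 9 * K * (cmod (u i))\<^sup>2 * \<bar>s\<bar> ^ 3) + (\<Sum>i\<in>I. 9 * K * \<bar>Re (u i)\<bar> * \<bar>s\<bar> ^ 3)"
      unfolding R_def by (intro order_trans[OF norm_triangle_ineq] add_mono)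
    also have "\<dots> = 9 * K * (\<Sum>i\<in>I. \<bar>Re (u i)\<bar> + (cmod (u i))\<^sup>2) * \<bar>s\<bar> ^ 3"
      by (simp add: sum.distrib sum_distrib_left sum_distrib_right algebra_simps)
    finally show ?thesis .
  qed
  ultimately show ?thesis by blast
qed

text \<open>
  The exceptional indices \<open>J\<close> may lower the variance, but by a bounded amount each; hence the others
  contribute at most \<open>v\<close> plus a multiple of \<open>card J\<close>.
\<close>

lemma sum_weights_le_variance:
  fixes u :: "'i \<Rightarrow> complex" and v C K :: real
  assumes fin: "finite I" and J: "J \<subseteq> I" and u: "\<And>i. i \<in> I \<Longrightarrow> cmod (u i) \<le> K"
    and K: "K \<ge> 1" and C: "C \<ge> 0"
    and good: "\<And>i. i \<in> I - J \<Longrightarrow> \<bar>Re (u i)\<bar> + (cmod (u i))\<^sup>2 \<le> C * Re (u i - (u i)\<^sup>2)"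
    and var: "(\<Sum>i\<in>I. u i - (u i)\<^sup>2) = of_real v"
  shows "(\<Sum>i\<in>I. \<bar>Re (u i)\<bar> + (cmod (u i))\<^sup>2) \<le> C * v + 2 * K\<^sup>2 * (1 + C) * real (card J)"
proof -
  have "\<bar>Re (u i)\<bar> + (cmod (u i))\<^sup>2
      \<le> C * Re (u i - (u i)\<^sup>2) + (if i \<in> J then 2 * K\<^sup>2 * (1 + C) else 0)" if "i \<in> I" for i
  proof (cases "i \<in> J")
    case True
    define a where "a = \<bar>Re (u i)\<bar> + (cmod (u i))\<^sup>2"
    have "\<bar>Re (u i)\<bar> \<le> K" "(cmod (u i))\<^sup>2 \<le> K\<^sup>2" "K \<le> K\<^sup>2"
      using u[OF that] abs_Re_le_cmod[of "u i"] K by (auto intro: power_mono self_le_power)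
    then have a: "a \<le> 2 * K\<^sup>2" unfolding a_def by linarith
    have "- Re (u i - (u i)\<^sup>2) \<le> a"
      using abs_Re_le_cmod[of "(u i)\<^sup>2"] by (simp add: a_def norm_power)
    then have "C * (- Re (u i - (u i)\<^sup>2)) \<le> C * (2 * K\<^sup>2)"
      using a C by (intro mult_left_mono) auto
    then show ?thesis using True a by (simp add: a_def algebra_simps)
  qed (use good that in auto)
  then have "(\<Sum>i\<in>I. \<bar>Re (u i)\<bar> + (cmod (u i))\<^sup>2)
      \<le> (\<Sum>i\<in>I. C * Re (u i - (u i)\<^sup>2) + (if i \<in> J then 2 * K\<^sup>2 * (1 + C) else 0))"
    by (rule sum_mono)
  also have "\<dots> = C * Re (\<Sum>i\<in>I. u i - (u i)\<^sup>2) + 2 * K\<^sup>2 * (1 + C) * real (card (I \<inter> J))"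
    using fin by (simp add: sum.distrib sum_subtractf flip: sum_distrib_left sum.inter_restrict)
  finally show ?thesis using var J by (simp add: Int_absorb1)
qed

text \<open>
  The constants \<open>A\<close> and \<open>K\<close> depend on \<open>\<delta>\<close> alone, so the estimate is uniform along a sequence of
  polynomials. The values of the derivatives say that \<open>\<mu>\<close> and \<open>v\<close> are the mean and the variance when \<open>p\<close>
  is a probability generating function.
\<close>

lemma poly_iexp_expansion:
  assumes \<delta>: "\<delta> > 0"
  obtains A K :: real where "A > 0" "K \<ge> 1"
    "\<And>(p :: complex poly) \<mu> v s.
      poly p 1 = 1 \<Longrightarrow> poly (pderiv p) 1 = of_real \<mu> \<Longrightarrow>
      poly (pderiv (pderiv p)) 1 = of_real (v + \<mu>\<^sup>2 - \<mu>) \<Longrightarrow> v \<ge> 0 \<Longrightarrow>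
      (\<And>\<zeta>. poly p \<zeta> = 0 \<Longrightarrow> cmod (1 - \<zeta>) > \<delta>) \<Longrightarrow> K * \<bar>s\<bar> \<le> 1/2 \<Longrightarrow>
      \<exists>R. cmod R \<le> A * (v + real (zeros_near_S \<delta> p)) * \<bar>s\<bar> ^ 3 \<and>
        poly p (iexp s) = exp (\<i> * s * \<mu> - s\<^sup>2 / 2 * v + R)"
proof -
  define K where "K = max 1 (1 / \<delta>)"
  have K: "K \<ge> 1" by (simp add: K_def)
  obtain C :: real where C: "C > 0"
    "\<And>\<zeta> u. \<zeta> \<noteq> 1 \<Longrightarrow> infdist \<zeta> region_S > \<delta> \<Longrightarrow> u = inverse (1 - \<zeta>) \<Longrightarrow>
      \<bar>Re u\<bar> + (cmod u)\<^sup>2 \<le> C * Re (u - u\<^sup>2)"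
    using variance_weight_dominates[OF \<delta>] by blast
  define B where "B = 2 * K\<^sup>2 * (1 + C)"
  have B: "B > 0" "C \<le> B"
  proof -
    have "1 \<le> K\<^sup>2" using K by simp
    then have "1 * (1 + C) \<le> (2 * K\<^sup>2) * (1 + C)" using C(1) by (intro mult_right_mono) auto
    then have "1 + C \<le> B" by (simp add: B_def)
    then show "B > 0" and "C \<le> B" using C(1) by simp_all
  qed
  have "\<exists>R. cmod R \<le> 9 * K * B * (v + real (zeros_near_S \<delta> p)) * \<bar>s\<bar> ^ 3 \<and>
      poly p (iexp s) = exp (\<i> * s * \<mu> - s\<^sup>2 / 2 * v + R)"
    if p1: "poly p 1 = 1" and d1: "poly (pderiv p) 1 = of_real \<mu>"
      and d2: "poly (pderiv (pderiv p)) 1 = of_real (v + \<mu>\<^sup>2 - \<mu>)"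
      and v: "v \<ge> 0" and roots: "\<And>\<zeta>. poly p \<zeta> = 0 \<Longrightarrow> cmod (1 - \<zeta>) > \<delta>"
      and s: "K * \<bar>s\<bar> \<le> 1/2"
    for p :: "complex poly" and \<mu> v s
  proof -
    obtain xs where xs: "mset xs = proots p" using ex_mset by blast
    define I where "I = {..<length xs}"
    define J where "J = {i. i < length xs \<and> infdist (xs ! i) region_S \<le> \<delta>}"
    define u where "u i = inverse (1 - xs ! i)" for i
    have p: "p = (\<Prod>i\<in>I. [:1 - u i, u i:])"
      using factorization_normalized_at_1[OF p1 xs] by (simp add: I_def u_def)
    have "p \<noteq> 0" using p1 by auto
    then have root: "cmod (1 - xs ! i) > \<delta>" if "i \<in> I" for i
      using roots[of "xs ! i"] that xs nth_mem_mset[of i xs]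
      by (auto simp: I_def set_count_proots)
    have u: "cmod (u i) \<le> K" if "i \<in> I" for i
    proof -
      have "inverse (cmod (1 - xs ! i)) \<le> inverse \<delta>"
        using root[OF that] \<delta> by (intro le_imp_inverse_le) auto
      then show ?thesis by (simp add: u_def norm_divide K_def inverse_eq_divide le_max_iff_disj)
    qed
    have fin: "finite I" by (simp add: I_def)
    have mean: "(\<Sum>i\<in>I. u i) = of_real \<mu>"
      using derivs_prod_factors_at_1(2)[OF fin, of u] d1 p by simp
    have var: "(\<Sum>i\<in>I. u i - (u i)\<^sup>2) = of_real v"
    proof -
      have "of_real v = poly (pderiv (pderiv p)) 1 - (of_real \<mu>)\<^sup>2 + of_real \<mu>"
        by (simp add: d2)
      also have "poly (pderiv (pderiv p)) 1 = (of_real \<mu>)\<^sup>2 - (\<Sum>i\<in>I. (u i)\<^sup>2)"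
        using derivs_prod_factors_at_1(3)[OF fin, of u] mean by (simp flip: p)
      finally show ?thesis by (simp add: sum_subtractf mean)
    qed
    have card: "card J = zeros_near_S \<delta> p"
      unfolding zeros_near_S_def xs[symmetric] J_def
      by (simp add: length_filter_conv_card flip: mset_filter)
    define W where "W = (\<Sum>i\<in>I. \<bar>Re (u i)\<bar> + (cmod (u i))\<^sup>2)"
    have "W \<le> C * v + B * real (card J)"
      unfolding W_def B_def
    proof (rule sum_weights_le_variance[OF fin _ u K])
      fix i assume i: "i \<in> I - J"
      have "xs ! i \<noteq> 1" using root[of i] i \<delta> by auto
      then show "\<bar>Re (u i)\<bar> + (cmod (u i))\<^sup>2 \<le> C * Re (u i - (u i)\<^sup>2)"
        using i by (intro C(2)[of "xs ! i"]) (auto simp: I_def J_def u_def)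
    qed (use C var in \<open>auto simp: I_def J_def\<close>)
    also have "\<dots> \<le> B * (v + real (zeros_near_S \<delta> p))"
      using B v by (simp add: card ring_distribs mult_right_mono)
    finally have W: "W \<le> B * (v + real (zeros_near_S \<delta> p))" .
    obtain R where R: "cmod R \<le> 9 * K * W * \<bar>s\<bar> ^ 3"
      "(\<Prod>i\<in>I. 1 + u i * (iexp s - 1)) = exp (\<i> * s * \<mu> - s\<^sup>2 / 2 * v + R)"
      using prod_factors_expansion[OF fin u K s mean var] unfolding W_def by blast
    have "poly p (iexp s) = (\<Prod>i\<in>I. 1 + u i * (iexp s - 1))"
      by (subst p) (simp add: poly_prod algebra_simps)
    moreover have "9 * K * W * \<bar>s\<bar> ^ 3 \<le> 9 * K * (B * (v + real (zeros_near_S \<delta> p))) * \<bar>s\<bar> ^ 3"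
      using W K by (intro mult_left_mono mult_right_mono) auto
    ultimately show ?thesis
      using R by (intro exI[of _ R]) (auto simp: mult_ac)
  qed
  moreover have "9 * K * B > 0" using K B by simp
  ultimately show thesis using K that[of "9 * K * B" K] by blast
qed

section \<open>The central limit theorem\<close>

lemma borel_measurable_real_finite_range:
  assumes "X \<in> measurable M (count_space {0..n})"
  shows "(\<lambda>\<omega>. real (X \<omega>)) \<in> borel_measurable M"
  using measurable_compose[OF assms, of real borel] by simp

text \<open>If the standard deviation is \<open>0\<close>, then \<open>s = 0\<close> and both sides are \<open>1\<close>.\<close>

lemma char_standardized:
  fixes t :: real
  assumes "prob_space M" and X: "X \<in> measurable M (count_space {0..n})"
  defines "s \<equiv> t / std_dev M X"
  shows "char (distr M borel (\<lambda>\<omega>. (real (X \<omega>) - mean M X) / std_dev M X)) t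
    = iexp (- (s * mean M X)) * poly (pgf M X n) (iexp s)"
proof -
  have [measurable]: "(\<lambda>\<omega>. real (X \<omega>)) \<in> borel_measurable M"
    using X by (rule borel_measurable_real_finite_range)
  have "char (distr M borel (\<lambda>\<omega>. (real (X \<omega>) - mean M X) / std_dev M X)) t
      = (\<integral>\<omega>. iexp (t * ((real (X \<omega>) - mean M X) / std_dev M X)) \<partial>M)"
    unfolding char_def by (subst integral_distr) auto
  also have "\<dots> = (\<integral>\<omega>. iexp (- (s * mean M X)) * iexp s ^ X \<omega> \<partial>M)"
    by (intro Bochner_Integration.integral_cong)
       (auto simp: s_def diff_divide_distrib algebra_simps exp_of_nat_mult[symmetric] simp flip: exp_add)
  also have "\<dots> = iexp (- (s * mean M X)) * (\<integral>\<omega>. iexp s ^ X \<omega> \<partial>M)"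
    by simp
  finally show ?thesis
    using poly_pgf_eq_integral[OF assms(1) X] by simp
qed

theorem theorem5:
  fixes \<delta> :: real
    and M :: "nat \<Rightarrow> 'a measure"
    and X :: "nat \<Rightarrow> 'a \<Rightarrow> nat"
  assumes "\<delta> > 0"
    and "\<And>n. prob_space (M n)"
    and "\<And>n. X n \<in> measurable (M n) (count_space {0..n})"
    and "filterlim (\<lambda>n. std_dev (M n) (X n)) at_top sequentially"
    and "\<And>n \<zeta>. poly (pgf (M n) (X n) n) \<zeta> = 0 \<Longrightarrow> cmod (1 - \<zeta>) > \<delta>"
    and "(\<lambda>n. real (zeros_near_S \<delta> (pgf (M n) (X n) n))) \<in> o(\<lambda>n. std_dev (M n) (X n) ^ 3)"
  shows "satisfies_clt M X"
  unfolding satisfies_clt_def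
proof (rule levy_continuity)
  fix n
  interpret prob_space "M n" by fact
  show "real_distribution (distr (M n) borel (\<lambda>\<omega>. (real (X n \<omega>) - mean (M n) (X n)) / std_dev (M n) (X n)))"
    by (intro real_distribution_distr borel_measurable_divide borel_measurable_diff
        borel_measurable_real_finite_range[OF assms(3)] borel_measurable_const)
next
  show "real_distribution std_normal_distribution" by (rule real_dist_normal_dist)
next
  fix t :: real
  define P where "P n = pgf (M n) (X n) n" for n
  define \<mu> where "\<mu> n = mean (M n) (X n)" for n
  define \<sigma> where "\<sigma> n = std_dev (M n) (X n)" for n
  define N where "N n = real (zeros_near_S \<delta> (P n))" for n
  define s where "s n = t / \<sigma> n" for n
  obtain A K :: real where AK: "A > 0" "K \<ge> 1" and expansion:
    "\<And>(p :: complex poly) \<mu> v s.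
      poly p 1 = 1 \<Longrightarrow> poly (pderiv p) 1 = of_real \<mu> \<Longrightarrow>
      poly (pderiv (pderiv p)) 1 = of_real (v + \<mu>\<^sup>2 - \<mu>) \<Longrightarrow> v \<ge> 0 \<Longrightarrow>
      (\<And>\<zeta>. poly p \<zeta> = 0 \<Longrightarrow> cmod (1 - \<zeta>) > \<delta>) \<Longrightarrow> K * \<bar>s\<bar> \<le> 1/2 \<Longrightarrow>
      \<exists>R. cmod R \<le> A * (v + real (zeros_near_S \<delta> p)) * \<bar>s\<bar> ^ 3 \<and>
        poly p (iexp s) = exp (\<i> * s * \<mu> - s\<^sup>2 / 2 * v + R)"
    using poly_iexp_expansion[OF assms(1)] by blast
  have "\<exists>R. K * \<bar>s n\<bar> \<le> 1/2 \<longrightarrow> cmod R \<le> A * ((\<sigma> n)\<^sup>2 + N n) * \<bar>s n\<bar> ^ 3 \<and>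
      poly (P n) (iexp (s n)) = exp (\<i> * s n * \<mu> n - (s n)\<^sup>2 / 2 * (\<sigma> n)\<^sup>2 + R)" for n
    using expansion[of "P n" "\<mu> n" "(\<sigma> n)\<^sup>2" "s n"] assms(5)[of n]
      poly_pgf_1[OF assms(2,3)] pderiv_pgf_at_1[OF assms(2,3)] pderiv2_pgf_at_1[OF assms(2,3)]
    unfolding P_def \<mu>_def \<sigma>_def N_def by (metis zero_le_power2)
  then obtain R where R:
    "\<And>n. K * \<bar>s n\<bar> \<le> 1/2 \<Longrightarrow> cmod (R n) \<le> A * ((\<sigma> n)\<^sup>2 + N n) * \<bar>s n\<bar> ^ 3"
    "\<And>n. K * \<bar>s n\<bar> \<le> 1/2 \<Longrightarrow>
      poly (P n) (iexp (s n)) = exp (\<i> * s n * \<mu> n - (s n)\<^sup>2 / 2 * (\<sigma> n)\<^sup>2 + R n)"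
    by metis
  have \<sigma>: "filterlim \<sigma> at_top sequentially"
    using assms(4) by (simp add: \<sigma>_def[abs_def])
  then have pos: "eventually (\<lambda>n. \<sigma> n > 0) sequentially"
    by (simp add: filterlim_at_top_dense)
  have "s \<longlonglongrightarrow> 0"
    unfolding s_def[abs_def] using \<sigma> by (intro tendsto_divide_0[OF tendsto_const] filterlim_at_top_imp_at_infinity)
  then have "(\<lambda>n. K * \<bar>s n\<bar>) \<longlonglongrightarrow> K * \<bar>0\<bar>"
    by (intro tendsto_intros)
  then have small: "eventually (\<lambda>n. K * \<bar>s n\<bar> \<le> 1/2) sequentially"
    by (auto dest!: order_tendstoD(2)[of _ _ _ "1/2"] elim: eventually_mono)
  have "R \<longlonglongrightarrow> 0"
  proof (rule Lim_null_comparison)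
    show "eventually (\<lambda>n. cmod (R n) \<le> A * \<bar>t\<bar> ^ 3 * (1 / \<sigma> n + N n / \<sigma> n ^ 3)) sequentially"
      using pos small
    proof eventually_elim
      case (elim n)
      have "A * ((\<sigma> n)\<^sup>2 + N n) * \<bar>s n\<bar> ^ 3 = A * \<bar>t\<bar> ^ 3 * (1 / \<sigma> n + N n / \<sigma> n ^ 3)"
        using elim(1) by (simp add: s_def field_simps power2_eq_square power3_eq_cube)
      with R(1)[OF elim(2)] show ?case by (rule ord_le_eq_trans)
    qed
    have "(\<lambda>n. N n / \<sigma> n ^ 3) \<longlonglongrightarrow> 0"
      using smalloD_tendsto[OF assms(6)] by (simp add: N_def P_def \<sigma>_def)
    moreover have "(\<lambda>n. 1 / \<sigma> n) \<longlonglongrightarrow> 0"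
      using \<sigma> by (intro tendsto_divide_0[OF tendsto_const] filterlim_at_top_imp_at_infinity)
    ultimately have "(\<lambda>n. A * \<bar>t\<bar> ^ 3 * (1 / \<sigma> n + N n / \<sigma> n ^ 3)) \<longlonglongrightarrow> A * \<bar>t\<bar> ^ 3 * (0 + 0)"
      by (intro tendsto_intros)
    then show "(\<lambda>n. A * \<bar>t\<bar> ^ 3 * (1 / \<sigma> n + N n / \<sigma> n ^ 3)) \<longlonglongrightarrow> 0" by simp
  qed
  then have "(\<lambda>n. exp (- of_real (t\<^sup>2) / 2 + R n)) \<longlonglongrightarrow> exp (- of_real (t\<^sup>2) / 2 + 0)"
    by (intro tendsto_intros)
  moreover have "eventually (\<lambda>n. exp (- of_real (t\<^sup>2) / 2 + R n)
      = char (distr (M n) borel (\<lambda>\<omega>. (real (X n \<omega>) - mean (M n) (X n)) / std_dev (M n) (X n))) t) sequentially"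
    using pos small
  proof eventually_elim
    case (elim n)
    have "char (distr (M n) borel (\<lambda>\<omega>. (real (X n \<omega>) - mean (M n) (X n)) / std_dev (M n) (X n))) t
        = iexp (- (s n * \<mu> n)) * poly (P n) (iexp (s n))"
      using char_standardized[OF assms(2,3)] by (simp add: s_def \<sigma>_def \<mu>_def P_def)
    also have "\<dots> = exp (- ((s n)\<^sup>2 * (\<sigma> n)\<^sup>2) / 2 + R n)"
      unfolding R(2)[OF elim(2)] by (simp add: algebra_simps flip: exp_add)
    also have "(s n)\<^sup>2 * (\<sigma> n)\<^sup>2 = t\<^sup>2"
      using elim(1) by (simp add: s_def power_divide)
    finally show ?case by simp
  qed
  ultimately show "(\<lambda>n. char (distr (M n) borel
      (\<lambda>\<omega>. (real (X n \<omega>) - mean (M n) (X n)) / std_dev (M n) (X n))) t)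
      \<longlonglongrightarrow> char std_normal_distribution t"
    by (simp add: char_std_normal_distribution tendsto_cong exp_of_real[symmetric])
qed

end
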